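(* Let $K$ be a field and let $P=K[x_1,\dots,x_n]$ be non-negatively $\mathbb{Z}$-graded by $W\in\mathrm{Mat}_{1,n}(\mathbb{Z})$. Let $I$ be a $W$-homogeneous ideal in $P$ such that $I\cap P_0=\{0\}$, let $G=(g_1,\dots,g_r)$ be a tuple of $W$-homogeneous polynomials which generates $I$, and let $Z=(z_1,\dots,z_s)$ be a tuple of distinct indeterminates in $X=(x_1,\dots,x_n)$ of positive $W$-degrees. Let $e_1,\dots,e_s$ be the standard basis of $P_0^s$. Then the following conditions are equivalent. (a) There exists a $Z$-separating tuple of polynomials in $I$. (b) There exists a coherently $Z$-separating tuple of polynomials in $I$. (c) The elements $z_1,\dots,z_s$ are contained in the $P_0$-module generated by $\{\mathrm{lin}_Z(g_1),\dots,\mathrm{lin}_Z(g_r)\}$. (d) The vectors $e_1,\dots,e_s$ are contained in the $P_0$-module generated by $\{\mathrm{cvec}_Z(g_1),\dots,\mathrm{cvec}_Z(g_r)\}$.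
   Context: Grading: $W=(w_1,\dots,w_n)$ defines the $\mathbb{Z}$-grading on $P$ with $\deg_W(x_i)=w_i$ (nonzero constants have degree $0$); it is non-negative if all $w_i\ge 0$. $P_0$ is the degree-$0$ component, i.e. the polynomial ring over $K$ in the indeterminates of $W$-degree $0$. Separating tuples: $\mathrm{Supp}(h)$ is the set of terms (power products) occurring in $h$ with nonzero coefficient, and $\mathrm{LT}_\sigma(f)$ is the leading term (power product, without coefficient) of $f$ with respect to the term ordering $\sigma$. A tuple $F=(f_1,\dots,f_s)\in P^s$ is $Z$-separating if there is a term ordering $\sigma$ with $\mathrm{LT}_\sigma(f_i)=z_i$ for $i=1,\dots,s$. It is coherently $Z$-separating if $f_i=z_i-h_i$ with polynomials $h_i\in P$ such that $z_i$ divides no term in $\mathrm{Supp}(h_j)$ for all $i,j\in\{1,\dots,s\}$. A tuple is "in $I$" if all its entries lie in $I$. $Z$-linear part: a $W$-homogeneous polynomial $g$ is written uniquely as $g=c_1z_1+\cdots+c_sz_s+h$ with $c_1,\dots,c_s\in P_0$ and such that $\mathrm{Supp}(h)$ contains no term of the form $t\,z_i$ with $t\in P_0$. Then $\mathrm{lin}_Z(g)=c_1z_1+\cdots+c_sz_s$ and $\mathrm{cvec}_Z(g)=(c_1,\dots,c_s)\in P_0^s$. *)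

theory Defs
  imports Complex_Main "HOL-Library.Poly_Mapping" "HOL-Library.Function_Algebras"
begin

text \<open>
  The indeterminates are the elements of a finite type \<open>'x\<close>. A term (power product) is its exponent
  vector, so terms are multiplied by adding them and the term \<open>1\<close> is \<open>0\<close>. A polynomial is a finitely
  supported map from terms to coefficients, its support \<open>Supp\<close> being \<open>Poly_Mapping.keys\<close>.
\<close>

type_synonym 'x pterm = "'x \<Rightarrow>\<^sub>0 nat"
type_synonym ('x, 'k) mpoly = "'x pterm \<Rightarrow>\<^sub>0 'k"

definition var_term :: "'x \<Rightarrow> 'x pterm" where
  "var_term x = Poly_Mapping.single x 1"

definition var :: "'x \<Rightarrow> ('x, 'k::{zero,one}) mpoly" where
  "var x = Poly_Mapping.single (var_term x) 1"

definition term_dvd :: "'x pterm \<Rightarrow> 'x pterm \<Rightarrow> bool" where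
  "term_dvd t u \<longleftrightarrow> (\<exists>v. u = t + v)"

definition term_deg :: "('x::finite \<Rightarrow> int) \<Rightarrow> 'x pterm \<Rightarrow> int" where
  "term_deg W t = (\<Sum>x\<in>UNIV. W x * int (Poly_Mapping.lookup t x))"

definition graded_part :: "('x::finite \<Rightarrow> int) \<Rightarrow> int \<Rightarrow> ('x, 'k::zero) mpoly set" where
  "graded_part W d = {p. \<forall>t\<in>Poly_Mapping.keys p. term_deg W t = d}"

definition homogeneous :: "('x::finite \<Rightarrow> int) \<Rightarrow> ('x, 'k::zero) mpoly \<Rightarrow> bool" where
  "homogeneous W p \<longleftrightarrow> (\<exists>d. p \<in> graded_part W d)"

definition hom_component ::
    "('x::finite \<Rightarrow> int) \<Rightarrow> int \<Rightarrow> ('x, 'k::comm_monoid_add) mpoly \<Rightarrow> ('x, 'k) mpoly" where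
  "hom_component W d p =
    (\<Sum>t\<in>{t \<in> Poly_Mapping.keys p. term_deg W t = d}. Poly_Mapping.single t (Poly_Mapping.lookup p t))"

definition homogeneous_ideal ::
    "('x::finite \<Rightarrow> int) \<Rightarrow> ('x, 'k::comm_ring_1) mpoly set \<Rightarrow> bool" where
  "homogeneous_ideal W I \<longleftrightarrow>
    module.subspace (*) I \<and> (\<forall>p\<in>I. \<forall>d. hom_component W d p \<in> I)"

text \<open>\<open>(t, u) \<in> \<sigma>\<close> means that \<open>t\<close> is less than or equal to \<open>u\<close>.\<close>

definition term_ordering :: "'x pterm rel \<Rightarrow> bool" where
  "term_ordering \<sigma> \<longleftrightarrow>
    linear_order \<sigma> \<and>
    (\<forall>t u v. (t, u) \<in> \<sigma> \<longrightarrow> (t + v, u + v) \<in> \<sigma>) \<and>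
    (\<forall>t. (0, t) \<in> \<sigma>)"

text \<open>Meaningful for nonzero polynomials only.\<close>

definition lead_term :: "'x pterm rel \<Rightarrow> ('x, 'k::zero) mpoly \<Rightarrow> 'x pterm" where
  "lead_term \<sigma> f = (THE t. t \<in> Poly_Mapping.keys f \<and> (\<forall>u\<in>Poly_Mapping.keys f. (u, t) \<in> \<sigma>))"

definition separating :: "'x list \<Rightarrow> ('x, 'k::zero) mpoly list \<Rightarrow> bool" where
  "separating Z F \<longleftrightarrow>
    length F = length Z \<and>
    (\<exists>\<sigma>. term_ordering \<sigma> \<and>
      (\<forall>i<length Z. F ! i \<noteq> 0 \<and> lead_term \<sigma> (F ! i) = var_term (Z ! i)))"

definition coherently_separating :: "'x list \<Rightarrow> ('x, 'k::comm_ring_1) mpoly list \<Rightarrow> bool" where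
  "coherently_separating Z F \<longleftrightarrow>
    length F = length Z \<and>
    (\<exists>H. length H = length Z \<and>
      (\<forall>i<length Z. F ! i = var (Z ! i) - H ! i) \<and>
      (\<forall>i<length Z. \<forall>j<length Z. \<forall>t\<in>Poly_Mapping.keys (H ! j). \<not> term_dvd (var_term (Z ! i)) t))"

text \<open>
  An element of \<open>P\<^sub>0\<^sup>s\<close> is a function on \<open>nat\<close> with values in \<open>P\<^sub>0 = graded_part W 0\<close> on
  \<open>{..<s}\<close> and \<open>0\<close> elsewhere; components are counted from \<open>0\<close>.
\<close>

definition is_cvec ::
    "('x::finite \<Rightarrow> int) \<Rightarrow> 'x list \<Rightarrow> ('x, 'k::comm_ring_1) mpoly
      \<Rightarrow> (nat \<Rightarrow> ('x, 'k) mpoly) \<Rightarrow> bool" where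
  "is_cvec W Z g c \<longleftrightarrow>
    (\<forall>i<length Z. c i \<in> graded_part W 0) \<and> (\<forall>i\<ge>length Z. c i = 0) \<and>
    (\<exists>h. g = (\<Sum>i<length Z. c i * var (Z ! i)) + h \<and>
      (\<forall>u. \<forall>i<length Z. term_deg W u = 0 \<longrightarrow> u + var_term (Z ! i) \<notin> Poly_Mapping.keys h))"

definition cvec ::
    "('x::finite \<Rightarrow> int) \<Rightarrow> 'x list \<Rightarrow> ('x, 'k::comm_ring_1) mpoly
      \<Rightarrow> nat \<Rightarrow> ('x, 'k) mpoly" where
  "cvec W Z g = (THE c. is_cvec W Z g c)"

definition lin ::
    "('x::finite \<Rightarrow> int) \<Rightarrow> 'x list \<Rightarrow> ('x, 'k::comm_ring_1) mpoly \<Rightarrow> ('x, 'k) mpoly" where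
  "lin W Z g = (\<Sum>i<length Z. cvec W Z g i * var (Z ! i))"

definition unit_cvec :: "nat \<Rightarrow> nat \<Rightarrow> ('x, 'k::comm_ring_1) mpoly" where
  "unit_cvec i = (\<lambda>j. if j = i then 1 else 0)"

text \<open>
  \<open>P\<^sub>0\<close> is a subring and not a type, so \<open>module.span\<close> cannot be used for modules over it.
\<close>

definition submodule_over ::
    "'r set \<Rightarrow> ('r \<Rightarrow> 'm \<Rightarrow> 'm) \<Rightarrow> 'm::ab_group_add set \<Rightarrow> bool" where
  "submodule_over R scale M \<longleftrightarrow>
    0 \<in> M \<and> (\<forall>x\<in>M. \<forall>y\<in>M. x + y \<in> M) \<and> (\<forall>a\<in>R. \<forall>x\<in>M. scale a x \<in> M)"

definition span_over ::
    "'r set \<Rightarrow> ('r \<Rightarrow> 'm \<Rightarrow> 'm) \<Rightarrow> 'm::ab_group_add set \<Rightarrow> 'm set" where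
  "span_over R scale S = submodule_over R scale hull S"

definition vec_scale :: "'r::times \<Rightarrow> (nat \<Rightarrow> 'r) \<Rightarrow> nat \<Rightarrow> 'r" where
  "vec_scale a v = (\<lambda>i. a * v i)"

lemma term_deg_add: "term_deg W (t + u) = term_deg W t + term_deg W u"
  by (simp add: term_deg_def lookup_add algebra_simps sum.distrib)

lemma term_deg_zero_lookup:
  assumes "\<forall>x. 0 \<le> W x" "term_deg W t = 0" "0 < W x"
  shows "Poly_Mapping.lookup t x = 0"
proof -
  have "\<forall>x\<in>UNIV. W x * int (Poly_Mapping.lookup t x) = 0"
    using assms(1,2) unfolding term_deg_def by (subst (asm) sum_nonneg_eq_0_iff) auto
  then show ?thesis using assms(3) by (metis UNIV_I less_irrefl mult_eq_0_iff of_nat_eq_0_iff)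
qed

lemma mpoly_sum_induct [case_names single sum]:
  fixes p :: "('x, 'k::comm_monoid_add) mpoly"
  assumes single: "\<And>t a. Q (Poly_Mapping.single t a)" and sum: "\<And>f g. Q f \<Longrightarrow> Q g \<Longrightarrow> Q (f + g)"
  shows "Q p"
proof -
  have "Q (\<Sum>t\<in>S. Poly_Mapping.single t (Poly_Mapping.lookup p t))" if "finite S" for S
    using that
  proof (induction S)
    case empty
    then show ?case using single[of 0 0] by simp
  next
    case (insert t S)
    then show ?case using sum single by simp
  qed
  moreover have "p = (\<Sum>t\<in>Poly_Mapping.keys p. Poly_Mapping.single t (Poly_Mapping.lookup p t))"
    by (intro poly_mapping_eqI) (simp add: lookup_sum lookup_single when_def in_keys_iff)
  ultimately show ?thesis by (metis finite_keys)
qed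

lemma lookup_mult_monomial:
  fixes p :: "('x, 'k::comm_ring_1) mpoly"
  shows "Poly_Mapping.lookup (p * Poly_Mapping.single t 1) (u + t) = Poly_Mapping.lookup p u"
proof (induction p rule: mpoly_sum_induct)
  case (single s a)
  then show ?case by (auto simp: mult_single lookup_single when_def)
next
  case (sum f g)
  then show ?case by (simp add: distrib_right lookup_add)
qed

lemma keys_mult_monomial:
  fixes p :: "('x, 'k::comm_ring_1) mpoly"
  assumes "v \<in> Poly_Mapping.keys (p * Poly_Mapping.single t 1)"
  shows "\<exists>u\<in>Poly_Mapping.keys p. v = u + t"
  using assms keys_mult[of p "Poly_Mapping.single t 1"] by auto

lemma add_var_term_eq:
  assumes nonneg: "\<forall>x. 0 \<le> W x" and pos: "0 < W x" "0 < W y"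
    and "term_deg W u = 0" "term_deg W v = 0" "u + var_term x = v + var_term y"
  shows "x = y"
proof (rule ccontr)
  assume "x \<noteq> y"
  have "Poly_Mapping.lookup (u + var_term x) x = Poly_Mapping.lookup (v + var_term y) x" using assms(6) by simp
  then show False
    using \<open>x \<noteq> y\<close> term_deg_zero_lookup[OF nonneg assms(4) pos(1)]
      term_deg_zero_lookup[OF nonneg assms(5) pos(1)]
    by (simp add: lookup_add var_term_def lookup_single)
qed

lemma lookup_lin_sum:
  fixes c :: "nat \<Rightarrow> ('x::finite, 'k::comm_ring_1) mpoly"
  assumes nonneg: "\<forall>x. 0 \<le> W x" and dist: "distinct Z" and pos: "\<forall>z\<in>set Z. 0 < W z"
    and c: "\<forall>i<length Z. c i \<in> graded_part W 0"
    and j: "j < length Z" and u: "term_deg W u = 0"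
  shows "Poly_Mapping.lookup (\<Sum>i<length Z. c i * var (Z ! i)) (u + var_term (Z ! j)) = Poly_Mapping.lookup (c j) u"
proof -
  have "Poly_Mapping.lookup (c i * var (Z ! i)) (u + var_term (Z ! j)) = 0"
    if i: "i < length Z" "i \<noteq> j" for i
  proof (rule ccontr)
    assume "\<not> ?thesis"
    then obtain v where v: "v \<in> Poly_Mapping.keys (c i)" "u + var_term (Z ! j) = v + var_term (Z ! i)"
      using keys_mult_monomial[of "u + var_term (Z ! j)" "c i"] 
      unfolding var_def by (auto simp: in_keys_iff)
    then have "term_deg W v = 0" using c i by (auto simp: graded_part_def)
    then have "Z ! j = Z ! i" using add_var_term_eq[OF nonneg _ _ u _ v(2)] pos i j by auto
    then show False using dist i j by (simp add: nth_eq_iff_index_eq)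
  qed
  then have "Poly_Mapping.lookup (\<Sum>i<length Z. c i * var (Z ! i)) (u + var_term (Z ! j)) =
      (\<Sum>i<length Z. if i = j then Poly_Mapping.lookup (c j * var (Z ! j)) (u + var_term (Z ! j)) else 0)"
    unfolding lookup_sum by (intro sum.cong) auto
  also have "\<dots> = Poly_Mapping.lookup (c j) u" using j by (simp add: var_def lookup_mult_monomial)
  finally show ?thesis .
qed

lemma is_cvec_unique:
  assumes nonneg: "\<forall>x. 0 \<le> W x" and dist: "distinct Z" and pos: "\<forall>z\<in>set Z. 0 < W z"
    and c: "is_cvec W Z g c" "is_cvec W Z g c'"
  shows "c = c'"
proof
  have *: "Poly_Mapping.lookup (b j) u = (if term_deg W u = 0 then Poly_Mapping.lookup g (u + var_term (Z ! j)) else 0)"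
    if b: "is_cvec W Z g b" and j: "j < length Z" for b j u
  proof (cases "term_deg W u = 0")
    case True
    obtain h where h: "g = (\<Sum>i<length Z. b i * var (Z ! i)) + h"
      "\<forall>u. \<forall>i<length Z. term_deg W u = 0 \<longrightarrow> u + var_term (Z ! i) \<notin> Poly_Mapping.keys h"
      using b by (auto simp: is_cvec_def)
    have "Poly_Mapping.lookup h (u + var_term (Z ! j)) = 0" using h(2) True j by (simp add: in_keys_iff)
    then show ?thesis
      using lookup_lin_sum[OF nonneg dist pos _ j True, of b] b True
      unfolding is_cvec_def by (simp add: h(1) lookup_add)
  next
    case False
    then have "u \<notin> Poly_Mapping.keys (b j)"
      using b j by (auto simp: is_cvec_def graded_part_def simp del: in_keys_iff)
    then show ?thesis using False by (simp add: in_keys_iff)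
  qed
  fix j show "c j = c' j"
  proof (cases "j < length Z")
    case True
    then show ?thesis using *[OF c(1)] *[OF c(2)] by (intro poly_mapping_eqI) simp
  next
    case False
    then show ?thesis using c by (auto simp: is_cvec_def)
  qed
qed

lemma is_cvec_add:
  assumes "is_cvec W Z f b" "is_cvec W Z g c"
  shows "is_cvec W Z (f + g) (b + c)"
proof -
  obtain h k where
    h: "f = (\<Sum>i<length Z. b i * var (Z ! i)) + h"
      "\<forall>u. \<forall>i<length Z. term_deg W u = 0 \<longrightarrow> u + var_term (Z ! i) \<notin> Poly_Mapping.keys h" and
    k: "g = (\<Sum>i<length Z. c i * var (Z ! i)) + k"
      "\<forall>u. \<forall>i<length Z. term_deg W u = 0 \<longrightarrow> u + var_term (Z ! i) \<notin> Poly_Mapping.keys k"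
    using assms by (auto simp: is_cvec_def)
  have "f + g = (\<Sum>i<length Z. (b + c) i * var (Z ! i)) + (h + k)"
    by (simp add: h(1) k(1) distrib_right sum.distrib)
  moreover have "\<forall>u. \<forall>i<length Z. term_deg W u = 0 \<longrightarrow> u + var_term (Z ! i) \<notin> Poly_Mapping.keys (h + k)"
    using h(2) k(2) keys_add[of h k] by blast
  moreover have "(b + c) i \<in> graded_part W 0" if "i < length Z" for i
    using assms that keys_add[of "b i" "c i"] by (auto simp: is_cvec_def graded_part_def)
  moreover have "(b + c) i = 0" if "i \<ge> length Z" for i
    using assms that by (simp add: is_cvec_def)
  ultimately show ?thesis unfolding is_cvec_def by blast
qed

lemma is_cvec_exists: "\<exists>c. is_cvec W Z g c"
proof (induction g rule: mpoly_sum_induct)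
  case (single t a)
  show ?case
  proof (cases "\<exists>u. \<exists>i<length Z. term_deg W u = 0 \<and> t = u + var_term (Z ! i)")
    case True
    then obtain u i where ui: "i < length Z" "term_deg W u = 0" "t = u + var_term (Z ! i)" by blast
    define c where "c = (\<lambda>j. if j = i then Poly_Mapping.single u a else 0)"
    have "(\<Sum>j<length Z. c j * var (Z ! j)) =
        (\<Sum>j<length Z. if j = i then Poly_Mapping.single u a * var (Z ! i) else 0)"
      by (intro sum.cong) (auto simp: c_def)
    also have "\<dots> = Poly_Mapping.single t a" using ui by (simp add: var_def mult_single)
    finally have "is_cvec W Z (Poly_Mapping.single t a) c"
      unfolding is_cvec_def using ui by (auto simp: c_def graded_part_def intro!: exI[of _ 0])
    then show ?thesis by blast
  next
    case False
    then have "is_cvec W Z (Poly_Mapping.single t a) 0"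
      unfolding is_cvec_def by (auto simp: graded_part_def intro!: exI[of _ "Poly_Mapping.single t a"])
    then show ?thesis by blast
  qed
next
  case (sum f g)
  then show ?case using is_cvec_add by blast
qed

lemma is_cvec_cvec:
  assumes "\<forall>x. 0 \<le> W x" "distinct Z" "\<forall>z\<in>set Z. 0 < W z"
  shows "is_cvec W Z g (cvec W Z g)"
  unfolding cvec_def using is_cvec_exists is_cvec_unique[OF assms] by (metis theI)

end

theory Submission
  imports Defs
begin

text \<open>
  If \<open>g\<close> has no term of degree \<open>0\<close>, then multiplying \<open>g\<close> by a polynomial without degree-\<open>0\<close> terms
  kills its \<open>Z\<close>-linear part. As \<open>I \<inter> P\<^sub>0 = 0\<close>, the generators of \<open>I\<close> are of this kind, so the vectors \<open>cvec f\<close>, \<open>f \<in> I\<close>,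
  are exactly the \<open>P\<^sub>0\<close>-module \<open>M\<close> generated by the vectors of the generators. For a separating tuple
  these vectors form a matrix which is triangular with respect to \<open>\<sigma>\<close> and has nonzero constants on
  the diagonal, so \<open>M\<close> contains the unit vectors. Conversely, a unit vector in \<open>M\<close> yields some
  \<open>z - h \<in> I\<close>, homogeneous and such that \<open>h\<close> involves only those indeterminates of \<open>Z\<close> whose degree is
  smaller than that of \<open>z\<close>; by induction on the degree, these can be replaced modulo \<open>I\<close> by polynomials
  free of \<open>Z\<close>. Coherently separating tuples are separating for a lexicographic ordering
  in which the indeterminates of \<open>Z\<close> come first.
\<close>

section \<open>Modules over a subset of a ring\<close>

lemma span_over_base: "x \<in> S \<Longrightarrow> x \<in> span_over R scale S"
  unfolding span_over_def by (rule hull_inc)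

lemma submodule_over_span_over: "submodule_over R scale (span_over R scale S)"
  unfolding span_over_def by (rule hull_in) (auto simp: submodule_over_def)

lemma span_over_subset:
  assumes "S \<subseteq> M" "submodule_over R scale M"
  shows "span_over R scale S \<subseteq> M"
  unfolding span_over_def using assms by (rule hull_minimal)

lemma submodule_overD:
  assumes "submodule_over R scale M"
  shows submodule_over_0: "0 \<in> M"
    and submodule_over_add: "x \<in> M \<Longrightarrow> y \<in> M \<Longrightarrow> x + y \<in> M"
    and submodule_over_scale: "a \<in> R \<Longrightarrow> x \<in> M \<Longrightarrow> scale a x \<in> M"
  using assms by (auto simp: submodule_over_def)

lemma submodule_over_sum:
  assumes "submodule_over R scale M" "\<And>i. i \<in> A \<Longrightarrow> v i \<in> M"
  shows "sum v A \<in> M"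
  using assms(2)
  by (induction A rule: infinite_finite_induct)
    (auto intro: submodule_over_0[OF assms(1)] submodule_over_add[OF assms(1)])

lemma sum_fun_apply: "sum v A k = (\<Sum>j\<in>A. v j k)"
  for v :: "'a \<Rightarrow> 'b \<Rightarrow> 'c::comm_monoid_add"
  by (induction A rule: infinite_finite_induct) auto

lemma module_times: "module ((*) :: 'r::comm_ring_1 \<Rightarrow> 'r \<Rightarrow> 'r)"
  by unfold_locales (simp_all add: algebra_simps)

section \<open>Terms and term orderings\<close>

lemma term_diff_var:
  assumes "Poly_Mapping.lookup t x \<noteq> 0"
  obtains u where "t = u + var_term x"
proof
  show "t = (t - var_term x) + var_term x"
    using assms by (intro poly_mapping_eqI) (auto simp: lookup_add lookup_minus var_term_def lookup_single when_def)
qed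

text \<open>This is primality of \<open>z\<close> together with cancellation: an indeterminate that
  divides a product of two terms divides one of the factors. It serves to decide which factor of a
  product contributes the indeterminate of \<open>Z\<close> in a term of the \<open>Z\<close>-linear
  part.\<close>

lemma add_eq_add_var_term:
  assumes "v + w = t + var_term z"
  shows "(\<exists>v'. v = v' + var_term z \<and> v' + w = t) \<or> (\<exists>w'. w = w' + var_term z \<and> v + w' = t)"
proof -
  have "Poly_Mapping.lookup v z + Poly_Mapping.lookup w z \<noteq> 0"
    using assms by (metis lookup_add add_is_0 var_term_def lookup_single_eq one_neq_zero)
  then consider v' where "v = v' + var_term z" | w' where "w = w' + var_term z"
    by (metis add_is_0 term_diff_var)
  then show ?thesis
  proof cases
    case 1
    then have "(v' + w) + var_term z = t + var_term z" using assms by (simp add: ac_simps)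
    then show ?thesis using 1 by auto
  next
    case 2
    then have "(v + w') + var_term z = t + var_term z" using assms by (simp add: ac_simps)
    then show ?thesis using 2 by auto
  qed
qed

lemma term_dvd_var_iff: "term_dvd (var_term x) t \<longleftrightarrow> Poly_Mapping.lookup t x \<noteq> 0"
proof
  assume "term_dvd (var_term x) t"
  then show "Poly_Mapping.lookup t x \<noteq> 0"
    by (auto simp: term_dvd_def lookup_add var_term_def)
next
  assume "Poly_Mapping.lookup t x \<noteq> 0"
  then show "term_dvd (var_term x) t"
    by (metis term_diff_var term_dvd_def add.commute)
qed

lemma var_term_inject: "var_term x = var_term y \<longleftrightarrow> x = y"
  by (metis var_term_def lookup_single_eq lookup_single_not_eq one_neq_zero)

lemma term_deg_0 [simp]: "term_deg W 0 = 0"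
  by (simp add: term_deg_def)

lemma term_deg_var_term: "term_deg W (var_term x) = W x"
proof -
  have "term_deg W (var_term x) = (\<Sum>y\<in>UNIV. if y = x then W x else 0)"
    unfolding term_deg_def var_term_def by (intro sum.cong) (auto simp: lookup_single when_def)
  then show ?thesis by simp
qed

lemma term_deg_nonneg: "\<forall>x. 0 \<le> W x \<Longrightarrow> 0 \<le> term_deg W t"
  unfolding term_deg_def by (simp add: sum_nonneg)

lemma lookup_hom_component:
  "Poly_Mapping.lookup (hom_component W d p) t = (if term_deg W t = d then Poly_Mapping.lookup p t else 0)"
proof -
  have "Poly_Mapping.lookup (hom_component W d p) t =
      (\<Sum>s\<in>{s \<in> Poly_Mapping.keys p. term_deg W s = d}. if s = t then Poly_Mapping.lookup p t else 0)"
    unfolding hom_component_def lookup_sum by (intro sum.cong) (auto simp: lookup_single when_def)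
  then show ?thesis by (auto simp: in_keys_iff)
qed

lemma term_orderingD:
  assumes "term_ordering \<sigma>"
  shows term_ordering_refl: "(t, t) \<in> \<sigma>"
    and term_ordering_trans: "(t, u) \<in> \<sigma> \<Longrightarrow> (u, v) \<in> \<sigma> \<Longrightarrow> (t, v) \<in> \<sigma>"
    and term_ordering_antisym: "(t, u) \<in> \<sigma> \<Longrightarrow> (u, t) \<in> \<sigma> \<Longrightarrow> t = u"
    and term_ordering_total: "(t, u) \<in> \<sigma> \<or> (u, t) \<in> \<sigma>"
    and term_ordering_add_left: "(u, t + u) \<in> \<sigma>"
proof -
  have lin: "refl \<sigma>" "trans \<sigma>" "antisym \<sigma>" "total \<sigma>"
    using assms by (auto simp: term_ordering_def linear_order_on_def partial_order_on_def preorder_on_def)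
  show r: "(t, t) \<in> \<sigma>" for t using lin(1) by (simp add: refl_on_def)
  show "(t, u) \<in> \<sigma> \<Longrightarrow> (u, v) \<in> \<sigma> \<Longrightarrow> (t, v) \<in> \<sigma>" using lin(2) by (rule transD)
  show "(t, u) \<in> \<sigma> \<Longrightarrow> (u, t) \<in> \<sigma> \<Longrightarrow> t = u" using lin(3) by (rule antisymD)
  show "(t, u) \<in> \<sigma> \<or> (u, t) \<in> \<sigma>" using lin(4) r by (cases "t = u") (auto simp: total_on_def)
  have "(0 + u, t + u) \<in> \<sigma>" using assms unfolding term_ordering_def by blast
  then show "(u, t + u) \<in> \<sigma>" by simp
qed

lemma lead_term_eqI:
  assumes "term_ordering \<sigma>" "t \<in> Poly_Mapping.keys f" "\<And>u. u \<in> Poly_Mapping.keys f \<Longrightarrow> (u, t) \<in> \<sigma>"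
  shows "lead_term \<sigma> f = t"
  unfolding lead_term_def using assms term_ordering_antisym[OF assms(1)] by (intro the_equality) blast+

text \<open>A finite nonempty set has a maximum for a total order, so the definite description in
  \<open>lead_term\<close> denotes it for nonzero \<open>f\<close>.\<close>

lemma lead_term_max:
  assumes \<sigma>: "term_ordering \<sigma>" and "f \<noteq> 0"
  shows "lead_term \<sigma> f \<in> Poly_Mapping.keys f"
    and "\<And>u. u \<in> Poly_Mapping.keys f \<Longrightarrow> (u, lead_term \<sigma> f) \<in> \<sigma>"
proof -
  have "\<exists>t\<in>S. \<forall>u\<in>S. (u, t) \<in> \<sigma>" if "finite S" "S \<noteq> {}" for S
    using that
  proof (induction S rule: finite_ne_induct)
    case (singleton x)
    then show ?case using term_ordering_refl[OF \<sigma>] by simp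
  next
    case (insert x S)
    then obtain t where t: "t \<in> S" "\<forall>u\<in>S. (u, t) \<in> \<sigma>" by blast
    show ?case
    proof (cases "(x, t) \<in> \<sigma>")
      case True
      then show ?thesis using t by blast
    next
      case False
      then have "(t, x) \<in> \<sigma>" using term_ordering_total[OF \<sigma>] by blast
      then have "\<forall>u\<in>insert x S. (u, x) \<in> \<sigma>"
        using t(2) term_ordering_trans[OF \<sigma>] term_ordering_refl[OF \<sigma>] by blast
      then show ?thesis by blast
    qed
  qed
  then obtain t where t: "t \<in> Poly_Mapping.keys f" "\<forall>u\<in>Poly_Mapping.keys f. (u, t) \<in> \<sigma>"
    using \<open>f \<noteq> 0\<close> by (metis finite_keys keys_eq_empty)
  then have "lead_term \<sigma> f = t" using lead_term_eqI[OF \<sigma>] by blast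
  with t show "lead_term \<sigma> f \<in> Poly_Mapping.keys f"
    and "\<And>u. u \<in> Poly_Mapping.keys f \<Longrightarrow> (u, lead_term \<sigma> f) \<in> \<sigma>" by auto
qed

text \<open>Only the exponents of the listed indeterminates are compared, so antisymmetry requires
  the list to contain all of them. Repetitions are harmless: a second occurrence is reached only if
  the exponents already agree. Hence a list \<open>Z\<close> can be put in front of any
  enumeration.\<close>

fun lex_le :: "'x list \<Rightarrow> 'x pterm \<Rightarrow> 'x pterm \<Rightarrow> bool" where
  "lex_le [] t u \<longleftrightarrow> True"
| "lex_le (x # xs) t u \<longleftrightarrow> Poly_Mapping.lookup t x < Poly_Mapping.lookup u x \<or>
    Poly_Mapping.lookup t x = Poly_Mapping.lookup u x \<and> lex_le xs t u"

lemma lex_le_refl: "lex_le xs t t"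
  by (induction xs) auto

lemma lex_le_trans: "lex_le xs t u \<Longrightarrow> lex_le xs u v \<Longrightarrow> lex_le xs t v"
  by (induction xs) auto

lemma lex_le_antisym:
  "lex_le xs t u \<Longrightarrow> lex_le xs u t \<Longrightarrow> x \<in> set xs \<Longrightarrow> Poly_Mapping.lookup t x = Poly_Mapping.lookup u x"
  by (induction xs) auto

lemma lex_le_total: "lex_le xs t u \<or> lex_le xs u t"
  by (induction xs) auto

lemma lex_le_add: "lex_le xs t u \<Longrightarrow> lex_le xs (t + v) (u + v)"
  by (induction xs) (auto simp: lookup_add)

lemma lex_le_0: "lex_le xs 0 t"
  by (induction xs) auto

lemma term_ordering_lex:
  assumes "set xs = UNIV"
  shows "term_ordering {(t, u). lex_le xs t u}"
proof -
  have "antisym {(t, u). lex_le xs t u}"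
    using lex_le_antisym[of xs] assms by (auto intro!: antisymI poly_mapping_eqI)
  moreover have "trans {(t, u). lex_le xs t u}"
    using lex_le_trans by (auto intro!: transI)
  moreover have "total {(t, u). lex_le xs t u}"
    using lex_le_total by (auto simp: total_on_def)
  ultimately show ?thesis
    by (auto simp: term_ordering_def linear_order_on_def partial_order_on_def preorder_on_def
        refl_on_def lex_le_refl lex_le_add lex_le_0)
qed

text \<open>The exponents of \<open>t\<close> vanish on \<open>Z\<close>, so the comparison is
  decided at the first occurrence of \<open>z\<close> in \<open>Z\<close>, in favour of
  \<open>z\<close>, before \<open>xs\<close> is reached.\<close>

lemma lex_le_var_term:
  assumes "z \<in> set Z" "\<forall>x\<in>set Z. Poly_Mapping.lookup t x = 0"
  shows "lex_le (Z @ xs) t (var_term z)"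
  using assms by (induction Z) (auto simp: var_term_def lookup_single when_def)

lemma coherently_separating_imp_separating:
  fixes F :: "('x::finite, 'k::comm_ring_1) mpoly list"
  assumes "coherently_separating Z F"
  shows "separating Z F"
proof -
  obtain H where len: "length F = length Z" and F: "\<forall>i<length Z. F ! i = var (Z ! i) - H ! i"
    and H: "\<forall>i<length Z. \<forall>j<length Z. \<forall>t\<in>Poly_Mapping.keys (H ! j). \<not> term_dvd (var_term (Z ! i)) t"
    using assms unfolding coherently_separating_def by blast
  obtain xs :: "'x list" where xs: "set xs = UNIV" using finite_list[OF finite] by blast
  define \<sigma> where "\<sigma> = {(t, u). lex_le (Z @ xs) t u}"
  have \<sigma>: "term_ordering \<sigma>" unfolding \<sigma>_def by (rule term_ordering_lex) (simp add: xs)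
  have "F ! i \<noteq> 0 \<and> lead_term \<sigma> (F ! i) = var_term (Z ! i)" if i: "i < length Z" for i
  proof -
    have Hi: "\<forall>x\<in>set Z. Poly_Mapping.lookup t x = 0" if "t \<in> Poly_Mapping.keys (H ! i)" for t
      using H that i by (auto simp: term_dvd_var_iff in_set_conv_nth simp del: in_keys_iff)
    \<comment> \<open>An indeterminate divides itself, so coherence keeps it out of
      \<open>H ! i\<close> and it is not cancelled in \<open>F ! i\<close>.\<close>
    have "term_dvd (var_term (Z ! i)) (var_term (Z ! i))"
      unfolding term_dvd_var_iff by (simp add: var_term_def)
    then have "var_term (Z ! i) \<notin> Poly_Mapping.keys (H ! i)" using H i by blast
    then have "Poly_Mapping.lookup (F ! i) (var_term (Z ! i)) = 1"
      using F i by (simp add: lookup_minus var_def in_keys_iff)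
    then have key: "var_term (Z ! i) \<in> Poly_Mapping.keys (F ! i)" by (simp add: in_keys_iff)
    moreover have "(u, var_term (Z ! i)) \<in> \<sigma>" if "u \<in> Poly_Mapping.keys (F ! i)" for u
    proof -
      have "u = var_term (Z ! i) \<or> u \<in> Poly_Mapping.keys (H ! i)"
        using that F i by (auto simp: in_keys_iff lookup_minus var_def lookup_single when_def split: if_splits)
      then show ?thesis
        unfolding \<sigma>_def using Hi lex_le_var_term i by (fastforce simp: lex_le_refl)
    qed
    ultimately have "lead_term \<sigma> (F ! i) = var_term (Z ! i)" using lead_term_eqI[OF \<sigma>] by blast
    moreover have "F ! i \<noteq> 0" using key by auto
    ultimately show ?thesis by simp
  qed
  then show ?thesis using len \<sigma> unfolding separating_def by blast
qed

section \<open>Reduction to polynomials free of some indeterminates\<close>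

definition var_free :: "'x set \<Rightarrow> ('x, 'k::zero) mpoly \<Rightarrow> bool" where
  "var_free S p \<longleftrightarrow> (\<forall>t\<in>Poly_Mapping.keys p. \<forall>z\<in>S. Poly_Mapping.lookup t z = 0)"

lemma var_free_add: "var_free S p \<Longrightarrow> var_free S q \<Longrightarrow> var_free S (p + q)"
  using keys_add[of p q] unfolding var_free_def by blast

lemma var_free_mult: "var_free S p \<Longrightarrow> var_free S q \<Longrightarrow> var_free S (p * q)"
  unfolding var_free_def
proof (intro ballI)
  fix t z
  assume p: "\<forall>t\<in>Poly_Mapping.keys p. \<forall>z\<in>S. Poly_Mapping.lookup t z = 0"
    and q: "\<forall>t\<in>Poly_Mapping.keys q. \<forall>z\<in>S. Poly_Mapping.lookup t z = 0"
    and "t \<in> Poly_Mapping.keys (p * q)" and z: "z \<in> S"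
  then obtain u v where "t = u + v" "u \<in> Poly_Mapping.keys p" "v \<in> Poly_Mapping.keys q"
    using keys_mult[of p q] by blast
  then show "Poly_Mapping.lookup t z = 0" using p q z by (simp add: lookup_add del: in_keys_iff)
qed

text \<open>Equivalently, \<open>p\<close> lies in the sum of \<open>I\<close> and the subring of
  polynomials free of \<open>S\<close>. For an ideal \<open>I\<close> this sum is again a subring,
  which leaves only the indeterminates in \<open>S\<close> to be examined.\<close>

definition reducible :: "('x, 'k::comm_ring_1) mpoly set \<Rightarrow> 'x set \<Rightarrow> ('x, 'k) mpoly \<Rightarrow> bool" where
  "reducible I S p \<longleftrightarrow> (\<exists>q. var_free S q \<and> p - q \<in> I)"

lemma var_free_imp_reducible:
  assumes "module.subspace (*) I" "var_free S p"
  shows "reducible I S p"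
  using assms module.subspace_0[OF module_times] unfolding reducible_def by (intro exI[of _ p]) simp

lemma reducible_add:
  assumes I: "module.subspace (*) I" and "reducible I S p" "reducible I S p'"
  shows "reducible I S (p + p')"
proof -
  obtain q q' where q: "var_free S q" "p - q \<in> I" "var_free S q'" "p' - q' \<in> I"
    using assms by (auto simp: reducible_def)
  have "(p + p') - (q + q') = (p - q) + (p' - q')" by simp
  then have "(p + p') - (q + q') \<in> I" using module.subspace_add[OF module_times I] q by metis
  then show ?thesis using q var_free_add unfolding reducible_def by blast
qed

lemma reducible_mult:
  assumes I: "module.subspace (*) I" and "reducible I S p" "reducible I S p'"
  shows "reducible I S (p * p')"
proof -
  obtain q q' where q: "var_free S q" "p - q \<in> I" "var_free S q'" "p' - q' \<in> I"
    using assms by (auto simp: reducible_def)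
  have "p * p' - q * q' = p * (p' - q') + q' * (p - q)" by (simp add: algebra_simps)
  then have "p * p' - q * q' \<in> I"
    using module.subspace_add[OF module_times I] module.subspace_scale[OF module_times I] q by metis
  then show ?thesis using q var_free_mult unfolding reducible_def by blast
qed

lemma reducible_monomial:
  fixes t :: "'x::finite pterm"
  assumes I: "module.subspace (*) I"
    and "\<And>x. x \<in> S \<Longrightarrow> Poly_Mapping.lookup t x \<noteq> 0 \<Longrightarrow> reducible I S (var x)"
  shows "reducible I S (Poly_Mapping.single t a)"
  using assms(2)
\<comment> \<open>With all weights equal to 1, \<open>term_deg\<close> is the total degree, which
  drops by one whenever an indeterminate is split off.\<close>
proof (induction "nat (term_deg (\<lambda>_. 1) t)" arbitrary: t rule: less_induct)
  case less
  show ?case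
  proof (cases "\<exists>x\<in>S. Poly_Mapping.lookup t x \<noteq> 0")
    case True
    then obtain x where x: "x \<in> S" "Poly_Mapping.lookup t x \<noteq> 0" by blast
    obtain u where u: "t = u + var_term x" using x(2) by (rule term_diff_var)
    have "nat (term_deg (\<lambda>_. 1) u) < nat (term_deg (\<lambda>_. 1) t)"
      using term_deg_nonneg[of "\<lambda>_. 1" u] by (simp add: u term_deg_add term_deg_var_term)
    then have "reducible I S (Poly_Mapping.single u a)"
      using less.hyps less.prems by (simp add: u lookup_add)
    moreover have "Poly_Mapping.single t a = Poly_Mapping.single u a * var x"
      by (simp add: u var_def mult_single)
    ultimately show ?thesis using reducible_mult[OF I] less.prems[OF x] by metis
  next
    case False
    then have "var_free S (Poly_Mapping.single t a)"
      by (auto simp: var_free_def)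
    then show ?thesis by (rule var_free_imp_reducible[OF I])
  qed
qed

lemma reducible_poly:
  fixes p :: "('x::finite, 'k::comm_ring_1) mpoly"
  assumes I: "module.subspace (*) I"
    and p: "\<And>t x. t \<in> Poly_Mapping.keys p \<Longrightarrow> x \<in> S \<Longrightarrow> Poly_Mapping.lookup t x \<noteq> 0 \<Longrightarrow> reducible I S (var x)"
  shows "reducible I S p"
proof -
  have "reducible I S (\<Sum>t\<in>T. Poly_Mapping.single t (Poly_Mapping.lookup p t))"
    if "finite T" "T \<subseteq> Poly_Mapping.keys p" for T
    using that
  proof (induction T)
    case empty
    show ?case using var_free_imp_reducible[OF I] by (simp add: var_free_def)
  next
    case (insert t T)
    have "reducible I S (Poly_Mapping.single t (Poly_Mapping.lookup p t))"
      using insert.prems p by (intro reducible_monomial[OF I]) blast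
    then show ?case using insert reducible_add[OF I] by simp
  qed
  moreover have "p = (\<Sum>t\<in>Poly_Mapping.keys p. Poly_Mapping.single t (Poly_Mapping.lookup p t))"
    by (intro poly_mapping_eqI) (simp add: lookup_sum lookup_single when_def in_keys_iff)
  ultimately show ?thesis by (metis finite_keys order_refl)
qed

lemma reducible_imp_coherently_separating:
  assumes "\<And>z. z \<in> set Z \<Longrightarrow> reducible I (set Z) (var z)"
  shows "\<exists>F. set F \<subseteq> I \<and> coherently_separating Z F"
proof -
  obtain q where q: "\<And>z. z \<in> set Z \<Longrightarrow> var_free (set Z) (q z) \<and> var z - q z \<in> I"
    using assms unfolding reducible_def by metis
  have "\<not> term_dvd (var_term (Z ! i)) t"
    if "i < length Z" "j < length Z" "t \<in> Poly_Mapping.keys (map q Z ! j)" for i j t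
  proof -
    have "t \<in> Poly_Mapping.keys (q (Z ! j))" using that by simp
    then show ?thesis
      using q[OF nth_mem[OF that(2)]] nth_mem[OF that(1)] unfolding var_free_def term_dvd_var_iff by metis
  qed
  then have "coherently_separating Z (map (\<lambda>z. var z - q z) Z)"
    unfolding coherently_separating_def by (intro conjI exI[of _ "map q Z"]) simp_all
  moreover have "set (map (\<lambda>z. var z - q z) Z) \<subseteq> I" using q by auto
  ultimately show ?thesis by blast
qed

section \<open>Coefficient vectors\<close>

locale graded_indeterminates =
  fixes W :: "'x::finite \<Rightarrow> int" and Z :: "'x list"
  assumes nonneg: "\<forall>x. 0 \<le> W x" and dist: "distinct Z" and pos: "\<forall>z\<in>set Z. 0 < W z"
begin

lemmas is_cvec_cvec' = is_cvec_cvec[OF nonneg dist pos]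

lemma cvec_eqI: "is_cvec W Z g c \<Longrightarrow> cvec W Z g = c"
  using is_cvec_unique[OF nonneg dist pos] is_cvec_cvec' by blast

lemma cvec_graded: "i < length Z \<Longrightarrow> cvec W Z g i \<in> graded_part W 0"
  using is_cvec_cvec'[of g] by (simp add: is_cvec_def)

lemma cvec_outside: "i \<ge> length Z \<Longrightarrow> cvec W Z g i = 0"
  using is_cvec_cvec'[of g] by (simp add: is_cvec_def)

lemma cvec_0: "cvec W Z 0 = 0"
  by (rule cvec_eqI) (auto simp: is_cvec_def graded_part_def)

lemma cvec_add: "cvec W Z (f + g) = cvec W Z f + cvec W Z g"
  by (intro cvec_eqI is_cvec_add is_cvec_cvec')

text \<open>The remainder \<open>h\<close> has no term of this form, and in the linear part
  \<open>lookup_lin_sum\<close> isolates the \<open>j\<close>-th summand. The definite description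
  of \<open>cvec\<close> is thereby replaced by a coefficient of \<open>g\<close>.\<close>

lemma lookup_cvec:
  assumes "j < length Z" "term_deg W u = 0"
  shows "Poly_Mapping.lookup (cvec W Z g j) u = Poly_Mapping.lookup g (u + var_term (Z ! j))"
proof -
  obtain h where h: "g = (\<Sum>i<length Z. cvec W Z g i * var (Z ! i)) + h"
    "\<forall>u. \<forall>i<length Z. term_deg W u = 0 \<longrightarrow> u + var_term (Z ! i) \<notin> Poly_Mapping.keys h"
    using is_cvec_cvec'[of g] by (auto simp: is_cvec_def)
  have "Poly_Mapping.lookup h (u + var_term (Z ! j)) = 0"
    using h(2) assms by (simp add: in_keys_iff)
  moreover have "Poly_Mapping.lookup g v =
      Poly_Mapping.lookup (\<Sum>i<length Z. cvec W Z g i * var (Z ! i)) v + Poly_Mapping.lookup h v" for v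
    by (subst h(1)) (rule lookup_add)
  ultimately show ?thesis
    using lookup_lin_sum[OF nonneg dist pos _ assms, of "cvec W Z g"] by (simp add: cvec_graded)
qed

lemma deg_0_term_lookup:
  "term_deg W t = 0 \<Longrightarrow> z \<in> set Z \<Longrightarrow> Poly_Mapping.lookup t z = 0"
  using term_deg_zero_lookup[OF nonneg] pos by blast

lemma term_deg_add_eq_0_iff: "term_deg W (t + u) = 0 \<longleftrightarrow> term_deg W t = 0 \<and> term_deg W u = 0"
  using term_deg_nonneg[OF nonneg, of t] term_deg_nonneg[OF nonneg, of u] by (auto simp: term_deg_add)

text \<open>The remainder of \<open>a * g\<close> is \<open>a * h\<close>. Terms of \<open>a\<close>
  have degree 0 and so contain no indeterminate of \<open>Z\<close>. If a product of terms of
  \<open>a\<close> and \<open>h\<close> had the excluded form, its indeterminate of \<open>Z\<close>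
  would come from \<open>h\<close>, and the term of \<open>h\<close> would already have that
  form.\<close>

lemma cvec_scale:
  assumes a: "a \<in> graded_part W 0"
  shows "cvec W Z (a * g) = vec_scale a (cvec W Z g)"
proof (rule cvec_eqI)
  obtain h where h: "g = (\<Sum>i<length Z. cvec W Z g i * var (Z ! i)) + h"
    "\<forall>u. \<forall>i<length Z. term_deg W u = 0 \<longrightarrow> u + var_term (Z ! i) \<notin> Poly_Mapping.keys h"
    using is_cvec_cvec'[of g] by (auto simp: is_cvec_def)
  have "a * g = a * ((\<Sum>i<length Z. cvec W Z g i * var (Z ! i)) + h)" using h(1) by simp
  also have "\<dots> = (\<Sum>i<length Z. vec_scale a (cvec W Z g) i * var (Z ! i)) + a * h"
    by (simp add: distrib_left sum_distrib_left vec_scale_def mult.assoc)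
  finally have "a * g = (\<Sum>i<length Z. vec_scale a (cvec W Z g) i * var (Z ! i)) + a * h" .
  moreover have "u + var_term (Z ! i) \<notin> Poly_Mapping.keys (a * h)"
    if i: "i < length Z" and u: "term_deg W u = 0" for u i
  proof
    assume "u + var_term (Z ! i) \<in> Poly_Mapping.keys (a * h)"
    then obtain v w where vw: "v \<in> Poly_Mapping.keys a" "w \<in> Poly_Mapping.keys h"
      "v + w = u + var_term (Z ! i)"
      using keys_mult[of a h] by fastforce
    have "Poly_Mapping.lookup v (Z ! i) = 0"
      using vw(1) a i by (intro deg_0_term_lookup) (auto simp: graded_part_def simp del: in_keys_iff)
    then obtain w' where w': "w = w' + var_term (Z ! i)" "v + w' = u"
      using add_eq_add_var_term[OF vw(3)] by (auto simp: lookup_add var_term_def)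
    then have "term_deg W w' = 0" using u term_deg_add_eq_0_iff by blast
    then show False using h(2) i vw(2) w'(1) by blast
  qed
  moreover have "vec_scale a (cvec W Z g) i \<in> graded_part W 0" if "i < length Z" for i
    using a cvec_graded[OF that, of g] keys_mult[of a "cvec W Z g i"]
    by (fastforce simp: graded_part_def vec_scale_def term_deg_add simp del: in_keys_iff)
  ultimately show "is_cvec W Z (a * g) (vec_scale a (cvec W Z g))"
    unfolding is_cvec_def by (auto simp: vec_scale_def cvec_outside)
qed

text \<open>Suppose that two terms multiply to \<open>u + var_term (Z ! i)\<close> with
  \<open>u\<close> of degree 0. Removing the indeterminate from one factor leaves the other as a
  divisor of \<open>u\<close>. In a non-negative grading this divisor has degree 0, which both
  assumptions exclude.\<close>

lemma cvec_mult_pos: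
  assumes p: "\<And>t. t \<in> Poly_Mapping.keys p \<Longrightarrow> term_deg W t \<noteq> 0"
    and g: "\<And>t. t \<in> Poly_Mapping.keys g \<Longrightarrow> term_deg W t \<noteq> 0"
  shows "cvec W Z (p * g) = 0"
proof (rule cvec_eqI)
  have "u + var_term (Z ! i) \<notin> Poly_Mapping.keys (p * g)" if "term_deg W u = 0" for u i
  proof
    assume "u + var_term (Z ! i) \<in> Poly_Mapping.keys (p * g)"
    then obtain v w where vw: "v \<in> Poly_Mapping.keys p" "w \<in> Poly_Mapping.keys g"
      "v + w = u + var_term (Z ! i)"
      using keys_mult[of p g] by fastforce
    from add_eq_add_var_term[OF vw(3)] show False
      using p[OF vw(1)] g[OF vw(2)] that term_deg_add_eq_0_iff by blast
  qed
  then show "is_cvec W Z (p * g) 0"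
    unfolding is_cvec_def by (auto simp: graded_part_def intro!: exI[of _ "p * g"])
qed

lemma cvec_mult:
  assumes "\<And>t. t \<in> Poly_Mapping.keys g \<Longrightarrow> term_deg W t \<noteq> 0"
  shows "cvec W Z (p * g) = vec_scale (hom_component W 0 p) (cvec W Z g)"
proof -
  let ?p0 = "hom_component W 0 p"
  have "?p0 \<in> graded_part W 0"
    by (auto simp: graded_part_def in_keys_iff lookup_hom_component split: if_splits)
  moreover have "term_deg W t \<noteq> 0" if "t \<in> Poly_Mapping.keys (p - ?p0)" for t
    using that by (auto simp: in_keys_iff lookup_hom_component lookup_minus)
  moreover have "p * g = ?p0 * g + (p - ?p0) * g" by (simp add: algebra_simps)
  ultimately show ?thesis
    using cvec_scale[of ?p0 g] cvec_mult_pos[of "p - ?p0" g] assms by (metis cvec_add add.right_neutral)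
qed

section \<open>The module of coefficient vectors of an ideal\<close>

text \<open>By \<open>cvec_mult\<close>, a coefficient from P acts on the vector of a generator only
  through its degree-0 component. A combination over P thus becomes a combination over P_0.\<close>

lemma cvec_mem_span:
  assumes "\<And>g t. g \<in> S \<Longrightarrow> t \<in> Poly_Mapping.keys g \<Longrightarrow> term_deg W t \<noteq> 0"
    and "f \<in> module.span (*) S"
  shows "cvec W Z f \<in> span_over (graded_part W 0) vec_scale (cvec W Z ` S)"
  using assms(2)
proof (induction rule: module.span_induct_alt[OF module_times, consumes 1, case_names base step])
  case base
  then show ?case using submodule_over_span_over cvec_0 by (metis submodule_over_def)
next
  case (step p g f)
  let ?M = "span_over (graded_part W 0) vec_scale (cvec W Z ` S)"
  have "hom_component W 0 p \<in> graded_part W 0"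
    by (auto simp: graded_part_def in_keys_iff lookup_hom_component split: if_splits)
  moreover have "cvec W Z g \<in> ?M" using step by (intro span_over_base) simp
  moreover have "cvec W Z (p * g + f) = vec_scale (hom_component W 0 p) (cvec W Z g) + cvec W Z f"
    using cvec_mult[of g p] assms(1) step by (metis cvec_add)
  ultimately show ?case
    using step submodule_over_span_over[of "graded_part W 0" vec_scale "cvec W Z ` S"]
    unfolding submodule_over_def by metis
qed

text \<open>The ideal is a P_0-module and \<open>cvec\<close> is P_0-linear, so the image of
  \<open>I\<close> is a P_0-module; it contains the vectors of \<open>S\<close>.\<close>

lemma span_cvec_obtain:
  fixes I :: "('x, 'k::comm_ring_1) mpoly set"
  assumes I: "module.subspace (*) I" and "S \<subseteq> I"
    and "c \<in> span_over (graded_part W 0) vec_scale (cvec W Z ` S)"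
  obtains f where "f \<in> I" "cvec W Z f = c"
proof -
  have "submodule_over (graded_part W 0) vec_scale (cvec W Z ` I)"
    unfolding submodule_over_def
  proof (intro conjI ballI)
    show "0 \<in> cvec W Z ` I"
      using module.subspace_0[OF module_times I] cvec_0 by (metis image_eqI)
  next
    fix b c assume "b \<in> cvec W Z ` I" "c \<in> cvec W Z ` I"
    then show "b + c \<in> cvec W Z ` I"
      using module.subspace_add[OF module_times I] by (auto simp flip: cvec_add)
  next
    fix a :: "('x, 'k) mpoly" and c assume "a \<in> graded_part W 0" "c \<in> cvec W Z ` I"
    then show "vec_scale a c \<in> cvec W Z ` I"
      using module.subspace_scale[OF module_times I] by (auto simp flip: cvec_scale)
  qed
  then have "c \<in> cvec W Z ` I" using span_over_subset[OF image_mono[OF assms(2)]] assms(3) by blast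
  then show ?thesis using that by blast
qed

section \<open>From separating tuples to unit vectors\<close>

lemma unit_cvec_mem_if_separating:
  fixes F :: "('x, 'k::field) mpoly list"
  assumes M: "submodule_over (graded_part W 0) vec_scale M"
    and F: "\<And>f. f \<in> set F \<Longrightarrow> cvec W Z f \<in> M"
    and sep: "separating Z F" and i: "i < length Z"
  shows "unit_cvec i \<in> M"
proof -
  obtain \<sigma> where \<sigma>: "term_ordering \<sigma>" and len: "length F = length Z"
    and lead: "\<forall>i<length Z. F ! i \<noteq> 0 \<and> lead_term \<sigma> (F ! i) = var_term (Z ! i)"
    using sep unfolding separating_def by blast
  show ?thesis using i
  \<comment> \<open>The number of indeterminates up to \<open>Z ! i\<close> turns the order of
    \<open>Z\<close> under \<sigma> into a natural-number measure. This is forward substitution,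
    starting at the smallest indeterminate of \<open>Z\<close>.\<close>
  proof (induction "card {x. (var_term x, var_term (Z ! i)) \<in> \<sigma>}" arbitrary: i rule: less_induct)
    case less
    define c where "c = cvec W Z (F ! i)"
    have key: "var_term (Z ! i) \<in> Poly_Mapping.keys (F ! i)"
      and le: "\<And>u. u \<in> Poly_Mapping.keys (F ! i) \<Longrightarrow> (u, var_term (Z ! i)) \<in> \<sigma>"
      using lead_term_max[OF \<sigma>, of "F ! i"] lead less.prems by auto
    \<comment> \<open>A term \<open>u\<close> of \<open>c j\<close> comes from the term
      \<open>u + var_term (Z ! j)\<close> of \<open>F ! i\<close>, which the leading term
      bounds.\<close>
    have le': "term_deg W u = 0 \<and> (u + var_term (Z ! j), var_term (Z ! i)) \<in> \<sigma>"
      if "j < length Z" "u \<in> Poly_Mapping.keys (c j)" for j u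
    proof -
      have "term_deg W u = 0"
        using cvec_graded[OF that(1), of "F ! i"] that(2) unfolding c_def graded_part_def by blast
      then show ?thesis
        using lookup_cvec[OF that(1), of u "F ! i"] that(2) le unfolding c_def by (simp add: in_keys_iff)
    qed
    \<comment> \<open>Off the diagonal, a nonzero \<open>c j\<close> forces \<open>Z ! j\<close> to
      lie strictly below \<open>Z ! i\<close>, so the induction hypothesis provides
      \<open>unit_cvec j\<close>.\<close>
    have mem: "vec_scale (- c j) (unit_cvec j) \<in> M" if j: "j < length Z" "j \<noteq> i" for j
    proof (cases "c j = 0")
      case True
      then have "vec_scale (- c j) (unit_cvec j) = 0"
        by (auto simp: vec_scale_def fun_eq_iff)
      then show ?thesis using M by (simp add: submodule_over_def)
    next
      case False
      then obtain u where "u \<in> Poly_Mapping.keys (c j)" by (metis keys_eq_empty ex_in_conv)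
      then have ji: "(var_term (Z ! j), var_term (Z ! i)) \<in> \<sigma>"
        using le'[OF j(1)] term_ordering_add_left[OF \<sigma>] term_ordering_trans[OF \<sigma>] by blast
      have "Z ! j \<noteq> Z ! i" using j less.prems dist by (simp add: nth_eq_iff_index_eq)
      then have "(var_term (Z ! i), var_term (Z ! j)) \<notin> \<sigma>"
        using ji term_ordering_antisym[OF \<sigma>] var_term_inject by metis
      then have "{x. (var_term x, var_term (Z ! j)) \<in> \<sigma>} \<subset> {x. (var_term x, var_term (Z ! i)) \<in> \<sigma>}"
        using ji term_ordering_trans[OF \<sigma>] term_ordering_refl[OF \<sigma>] by blast
      then have "unit_cvec j \<in> M" using less.hyps j(1) by (simp add: psubset_card_mono)
      moreover have "- c j \<in> graded_part W 0"
        using cvec_graded[OF j(1), of "F ! i"] by (simp add: c_def graded_part_def in_keys_iff)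
      ultimately show ?thesis using M by (simp add: submodule_over_def)
    qed
    define a where "a = Poly_Mapping.lookup (F ! i) (var_term (Z ! i))"
    have "a \<noteq> 0" using key by (simp add: a_def in_keys_iff)
    \<comment> \<open>On the diagonal, \<open>u + var_term (Z ! i)\<close> lies both above and below
      \<open>var_term (Z ! i)\<close>, which leaves only \<open>u = 0\<close>. The entry is a
      nonzero constant, invertible over a field.\<close>
    have "c i = Poly_Mapping.single 0 a"
    proof (rule poly_mapping_eqI)
      fix u
      show "Poly_Mapping.lookup (c i) u = Poly_Mapping.lookup (Poly_Mapping.single 0 a) u"
      proof (cases "u = 0")
        case True
        then show ?thesis using lookup_cvec[OF less.prems, of 0 "F ! i"] by (simp add: c_def a_def)
      next
        case False
        have "u \<notin> Poly_Mapping.keys (c i)"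
          using le'[OF less.prems] term_ordering_add_left[OF \<sigma>] term_ordering_antisym[OF \<sigma>] False
          by (metis add_cancel_left_left)
        then show ?thesis using False by (simp add: in_keys_iff lookup_single)
      qed
    qed
    then have unit: "Poly_Mapping.single 0 (inverse a) * c i = 1"
      using \<open>a \<noteq> 0\<close> by (simp add: mult_single)
    \<comment> \<open>For \<open>k\<close> beyond the length of \<open>Z\<close> both sides are 0,
      by the default value of \<open>cvec\<close>.\<close>
    have expand: "(\<Sum>j<length Z. c j * unit_cvec j k) = c k" for k
    proof -
      have "(\<Sum>j<length Z. c j * unit_cvec j k) = (\<Sum>j<length Z. if k = j then c k else 0)"
        by (intro sum.cong) (auto simp: unit_cvec_def)
      then show ?thesis using cvec_outside[of k "F ! i"] by (auto simp: c_def)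
    qed
    have "c k - (\<Sum>j\<in>{..<length Z} - {i}. c j * unit_cvec j k) = c i * unit_cvec i k" for k
      using sum.remove[of "{..<length Z}" i "\<lambda>j. c j * unit_cvec j k"] less.prems
      unfolding expand by simp
    then have "c + (\<Sum>j\<in>{..<length Z} - {i}. vec_scale (- c j) (unit_cvec j)) = vec_scale (c i) (unit_cvec i)"
      by (intro ext) (simp add: sum_fun_apply vec_scale_def sum_negf)
    moreover have "c \<in> M" unfolding c_def using F len less.prems by simp
    moreover have "(\<Sum>j\<in>{..<length Z} - {i}. vec_scale (- c j) (unit_cvec j)) \<in> M"
      using mem by (intro submodule_over_sum[OF M]) auto
    ultimately have "vec_scale (c i) (unit_cvec i) \<in> M"
      using submodule_over_add[OF M, of c] by (elim subst)
    moreover have "Poly_Mapping.single 0 (inverse a) \<in> graded_part W 0"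
      by (auto simp: graded_part_def)
    ultimately have "vec_scale (Poly_Mapping.single 0 (inverse a)) (vec_scale (c i) (unit_cvec i)) \<in> M"
      using submodule_over_scale[OF M] by blast
    moreover have "vec_scale (Poly_Mapping.single 0 (inverse a)) (vec_scale (c i) (unit_cvec i)) = unit_cvec i"
      using unit by (simp add: vec_scale_def mult.assoc[symmetric])
    ultimately show ?case by simp
  qed
qed

section \<open>From unit vectors to reductions of the indeterminates\<close>

lemma var_reducible_if_unit_cvec:
  fixes I :: "('x, 'k::comm_ring_1) mpoly set"
  assumes I: "homogeneous_ideal W I"
    and unit: "\<And>i. i < length Z \<Longrightarrow> \<exists>f\<in>I. cvec W Z f = unit_cvec i"
    and z: "z \<in> set Z"
  shows "reducible I (set Z) (var z)"
  using z
proof (induction "nat (W z)" arbitrary: z rule: less_induct)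
  case less
  have sub: "module.subspace (*) I" using I by (simp add: homogeneous_ideal_def)
  obtain i where i: "i < length Z" "Z ! i = z" using less.prems by (auto simp: in_set_conv_nth)
  obtain f where f: "f \<in> I" "cvec W Z f = unit_cvec i" using unit[OF i(1)] by blast
  \<comment> \<open>The component in the degree of \<open>z\<close> retains the term
    \<open>z\<close> with coefficient 1 and gives all other terms that same degree, which makes
    degrees of cofactors comparable.\<close>
  define g where "g = hom_component W (W z) f"
  have g: "g \<in> I" using I f(1) by (simp add: homogeneous_ideal_def g_def)
  \<comment> \<open>In coefficients: among the terms with an indeterminate of \<open>Z\<close> and a
    cofactor of degree 0, only \<open>z\<close> occurs in \<open>f\<close>.\<close>
  have lookup_f: "Poly_Mapping.lookup f (u + var_term (Z ! j)) = (if j = i \<and> u = 0 then 1 else 0)"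
    if "j < length Z" "term_deg W u = 0" for u j
    by (subst lookup_cvec[OF that, symmetric]) (auto simp: f(2) unit_cvec_def lookup_one)
  have "reducible I (set Z) (g - var z)"
  proof (rule reducible_poly[OF sub])
    fix t x assume t: "t \<in> Poly_Mapping.keys (g - var z)" and x: "x \<in> set Z" "Poly_Mapping.lookup t x \<noteq> 0"
    have "Poly_Mapping.lookup g (var_term z) = 1"
      using lookup_f[OF i(1), of 0] i(2) by (simp add: g_def lookup_hom_component term_deg_var_term)
    then have tz: "t \<noteq> var_term z" using t by (auto simp: in_keys_iff lookup_minus var_def)
    then have tg: "Poly_Mapping.lookup f t \<noteq> 0" "term_deg W t = W z"
      using t by (auto simp: in_keys_iff lookup_minus var_def lookup_single g_def lookup_hom_component
          split: if_splits)
    obtain u where u: "t = u + var_term x" using x(2) by (rule term_diff_var)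
    obtain j where j: "j < length Z" "Z ! j = x" using x(1) by (auto simp: in_set_conv_nth)
    \<comment> \<open>A cofactor of degree 0 would make \<open>t\<close> equal to \<open>z\<close>,
      which was subtracted. So \<open>u\<close> takes up positive degree and \<open>x\<close> has
      smaller degree than \<open>z\<close>.\<close>
    have "term_deg W u \<noteq> 0"
    proof
      assume "term_deg W u = 0"
      then have "j = i \<and> u = 0" using lookup_f[OF j(1)] tg(1) u j(2) by metis
      then show False using tz u i j by simp
    qed
    then have "0 < term_deg W u" using term_deg_nonneg[OF nonneg, of u] by simp
    moreover have "term_deg W u + W x = W z" using tg(2) by (simp add: u term_deg_add term_deg_var_term)
    ultimately have "nat (W x) < nat (W z)" using pos less.prems by fastforce
    then show "reducible I (set Z) (var x)" using less.hyps x(1) by blast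
  qed
  then obtain q where q: "var_free (set Z) q" "(g - var z) - q \<in> I" unfolding reducible_def by blast
  \<comment> \<open>Modulo \<open>I\<close>, \<open>g\<close> vanishes and \<open>g - var z\<close>
    is congruent to \<open>q\<close>, so \<open>var z\<close> is congruent to
    \<open>- q\<close>.\<close>
  have "var z - (- q) = g - ((g - var z) - q)" by simp
  then have "var z - (- q) \<in> I" using module.subspace_diff[OF module_times sub g q(2)] by metis
  moreover have "var_free (set Z) (- q)" using q(1) by (simp add: var_free_def in_keys_iff)
  ultimately show ?case unfolding reducible_def by blast
qed

section \<open>Comparison of linear parts and coefficient vectors\<close>

definition lin_comb :: "(nat \<Rightarrow> ('x, 'k::comm_ring_1) mpoly) \<Rightarrow> ('x, 'k) mpoly" where
  "lin_comb c = (\<Sum>i<length Z. c i * var (Z ! i))"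

lemma lin_comb_simps:
  "lin_comb 0 = 0" "lin_comb (b + c) = lin_comb b + lin_comb c" "lin_comb (vec_scale a c) = a * lin_comb c"
  "lin W Z g = lin_comb (cvec W Z g)"
  by (simp_all add: lin_comb_def lin_def vec_scale_def distrib_right sum.distrib sum_distrib_left mult.assoc)

lemma lin_comb_unit_cvec:
  assumes "i < length Z"
  shows "lin_comb (unit_cvec i) = var (Z ! i)"
proof -
  have "lin_comb (unit_cvec i) = (\<Sum>j<length Z. if j = i then var (Z ! i) else 0)"
    unfolding lin_comb_def by (intro sum.cong) (auto simp: unit_cvec_def)
  then show ?thesis using assms by simp
qed

text \<open>The remainder is 0. Hence \<open>lin_comb\<close> is an isomorphism from P_0^s onto the
  free P_0-module with basis Z, with inverse \<open>cvec\<close>, and it carries (d) to (c).\<close>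

lemma cvec_lin_comb:
  assumes "\<forall>i<length Z. c i \<in> graded_part W 0" "\<forall>i\<ge>length Z. c i = 0"
  shows "cvec W Z (lin_comb c) = c"
  using assms by (intro cvec_eqI) (auto simp: is_cvec_def lin_comb_def intro!: exI[of _ 0])

text \<open>The preimage of a submodule under the P_0-linear map \<open>lin_comb\<close> is a
  submodule, and here it contains the generators.\<close>

lemma lin_comb_mem_span:
  assumes "c \<in> span_over (graded_part W 0) vec_scale (cvec W Z ` S)"
  shows "lin_comb c \<in> span_over (graded_part W 0) (*) (lin W Z ` S)"
proof -
  let ?N = "span_over (graded_part W 0) (*) (lin W Z ` S)"
  have "submodule_over (graded_part W 0) vec_scale {c. lin_comb c \<in> ?N}"
    using submodule_over_span_over[of "graded_part W 0" "(*)" "lin W Z ` S"]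
    by (simp add: submodule_over_def lin_comb_simps)
  moreover have "cvec W Z ` S \<subseteq> {c. lin_comb c \<in> ?N}"
    by (auto simp flip: lin_comb_simps(4) intro!: span_over_base)
  ultimately show ?thesis using span_over_subset assms by blast
qed

lemma cvec_lin_comb_cvec: "cvec W Z (lin_comb (cvec W Z g)) = cvec W Z g"
  using cvec_lin_comb cvec_graded cvec_outside by blast

text \<open>The same preimage argument for \<open>cvec\<close>; a polynomial and its linear part
  have the same coefficient vector.\<close>

lemma cvec_mem_span_of_lin:
  assumes "g \<in> span_over (graded_part W 0) (*) (lin W Z ` S)"
  shows "cvec W Z g \<in> span_over (graded_part W 0) vec_scale (cvec W Z ` S)"
proof -
  let ?M = "span_over (graded_part W 0) vec_scale (cvec W Z ` S)"
  have "submodule_over (graded_part W 0) (*) {g. cvec W Z g \<in> ?M}"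
    using submodule_over_span_over[of "graded_part W 0" vec_scale "cvec W Z ` S"]
    by (simp add: submodule_over_def cvec_0 cvec_add cvec_scale)
  moreover have "lin W Z ` S \<subseteq> {g. cvec W Z g \<in> ?M}"
    by (auto simp: lin_comb_simps(4) cvec_lin_comb_cvec intro!: span_over_base)
  ultimately show ?thesis using span_over_subset assms by blast
qed

lemma var_mem_span_lin_iff:
  assumes "i < length Z"
  shows "var (Z ! i) \<in> span_over (graded_part W 0) (*) (lin W Z ` S) \<longleftrightarrow>
    unit_cvec i \<in> span_over (graded_part W 0) vec_scale (cvec W Z ` S)"
proof -
  have "cvec W Z (var (Z ! i)) = unit_cvec i"
    unfolding lin_comb_unit_cvec[OF assms, symmetric]
    using assms by (intro cvec_lin_comb) (auto simp: unit_cvec_def graded_part_def)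
  then show ?thesis
    using cvec_mem_span_of_lin lin_comb_mem_span lin_comb_unit_cvec[OF assms] by metis
qed

end

theorem theorem3p3:
  fixes W :: "'x::finite \<Rightarrow> int"
    and I :: "('x, 'k::field) mpoly set"
    and G :: "('x, 'k) mpoly list"
    and Z :: "'x list"
  assumes "\<forall>x. 0 \<le> W x"
    and "homogeneous_ideal W I"
    and "I \<inter> graded_part W 0 = {0}"
    and "\<forall>g\<in>set G. homogeneous W g"
    and "module.span (*) (set G) = I"
    and "distinct Z"
    and "\<forall>z\<in>set Z. 0 < W z"
  shows
    "((\<exists>F. set F \<subseteq> I \<and> separating Z F) \<longleftrightarrow>
        (\<exists>F. set F \<subseteq> I \<and> coherently_separating Z F)) \<and>
     ((\<exists>F. set F \<subseteq> I \<and> separating Z F) \<longleftrightarrow>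
        (\<forall>z\<in>set Z. var z \<in> span_over (graded_part W 0) (*) (lin W Z ` set G))) \<and>
     ((\<exists>F. set F \<subseteq> I \<and> separating Z F) \<longleftrightarrow>
        (\<forall>i<length Z. unit_cvec i \<in> span_over (graded_part W 0) vec_scale (cvec W Z ` set G)))"
proof -
  interpret graded_indeterminates W Z by unfold_locales fact+
  let ?M = "span_over (graded_part W 0) vec_scale (cvec W Z ` set G)"
  have I: "module.subspace (*) I" using assms(2) by (simp add: homogeneous_ideal_def)
  have GI: "set G \<subseteq> I" using module.span_superset[OF module_times] assms(5) by blast
  \<comment> \<open>A homogeneous generator with a term of degree 0 would lie entirely in P_0, hence
    in the zero intersection of \<open>I\<close> with P_0.\<close>
  have G: "term_deg W t \<noteq> 0" if g: "g \<in> set G" and t: "t \<in> Poly_Mapping.keys g" for g t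
  proof
    assume "term_deg W t = 0"
    then have "g \<in> graded_part W 0"
      using assms(4) g t by (auto simp: homogeneous_def graded_part_def simp del: in_keys_iff)
    then have "g = 0" using assms(3) GI g by blast
    then show False using t by simp
  qed
  have ad: "\<forall>i<length Z. unit_cvec i \<in> ?M" if F: "set F \<subseteq> I" "separating Z F" for F
  proof (intro allI impI unit_cvec_mem_if_separating[OF submodule_over_span_over _ F(2)])
    fix f assume "f \<in> set F"
    then have "f \<in> module.span (*) (set G)" using F(1) assms(5) by blast
    then show "cvec W Z f \<in> ?M" using G by (intro cvec_mem_span)
  qed
  have db: "\<exists>F. set F \<subseteq> I \<and> coherently_separating Z F" if d: "\<forall>i<length Z. unit_cvec i \<in> ?M"
  proof (intro reducible_imp_coherently_separating var_reducible_if_unit_cvec[OF assms(2)])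
    fix i assume "i < length Z"
    then obtain f where "f \<in> I" "cvec W Z f = unit_cvec i"
      using d span_cvec_obtain[OF I GI, of "unit_cvec i"] by blast
    then show "\<exists>f\<in>I. cvec W Z f = unit_cvec i" by blast
  qed
  have cd: "(\<forall>z\<in>set Z. var z \<in> span_over (graded_part W 0) (*) (lin W Z ` set G)) \<longleftrightarrow>
      (\<forall>i<length Z. unit_cvec i \<in> ?M)"
    unfolding all_set_conv_all_nth by (simp add: var_mem_span_lin_iff)
  \<comment> \<open>The cycle runs from (a) to (d) by \<open>ad\<close>, to (b) by
    \<open>db\<close>, and back to (a) by the lexicographic ordering; \<open>cd\<close> adds
    (c).\<close>
  show ?thesis
    unfolding cd using ad db coherently_separating_imp_separating by blast
qed

end
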